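(* Let $y^* \in \mathbb{Z}_{\ge 0}^{|\mathcal{I}|}$ and let $\mathcal{L} := \{ i \in \mathcal{I}_{\mathrm{P}} : a_i(y^* ) \ge 1 - c(y^* )\}$. Then the enhanced outer-approximation inequality $$\eta \le c(y^* ) + \sum_{i \in \mathcal{I}_{\mathrm{P}} \setminus \mathcal{L}} a_i(y^* ) y_i + (1 - c(y^* )) \sum_{i \in \mathcal{I}_{\mathrm{F}} \cup \mathcal{L}} z_i$$ is valid for $\mathcal{X}$ (i.e. satisfied by every $(\eta,y,z) \in \mathcal{X}$). Moreover, it is stronger than the outer-approximation inequality $\eta \le c(y^* ) + \sum_{i \in \mathcal{I}_{\mathrm{P}}} a_i(y^* ) y_i + \sum_{i \in \mathcal{I}_{\mathrm{F}}} y_i$, in the sense that for all $(y,z) \in \mathbb{R}_{\ge 0}^{|\mathcal{I}|} \times [0,1]^{|\mathcal{I}|}$ with $z_i \le y_i \le K z_i$ for all $i \in \mathcal{I}$, $$c(y^* ) + \sum_{i \in \mathcal{I}_{\mathrm{P}} \setminus \mathcal{L}} a_i(y^* ) y_i + (1 - c(y^* )) \sum_{i \in \mathcal{I}_{\mathrm{F}} \cup \mathcal{L}} z_i \ \le\ c(y^* ) + \sum_{i \in \mathcal{I}_{\mathrm{P}}} a_i(y^* ) y_i + \sum_{i \in \mathcal{I}_{\mathrm{F}}} y_i .$$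
   Context: $\mathcal{I}$ is a finite set, $K \ge 2$ is an integer, and $p_i \in [0,1]$ for each $i \in \mathcal{I}$. Put $\mathcal{I}_{\mathrm{P}} = \{i \in \mathcal{I} : 0 \le p_i < 1\}$ and $\mathcal{I}_{\mathrm{F}} = \{i \in \mathcal{I} : p_i = 1\}$. The convention $0^0 = 1$ is used. Define $$\mathcal{X} = \Big\{(\eta,y,z) \in \mathbb{R} \times \mathbb{Z}_{\ge 0}^{|\mathcal{I}|} \times \{0,1\}^{|\mathcal{I}|} : \eta \le 1 - \prod_{i \in \mathcal{I}} (1-p_i)^{y_i},\ z_i \le y_i \le K z_i \ \text{for all } i \in \mathcal{I}\Big\}.$$ For $y^* \in \mathbb{Z}_{\ge 0}^{|\mathcal{I}|}$ define $$c(y^* ) := 1 - \prod_{i \in \mathcal{I}_{\mathrm{P}}} (1-p_i)^{y_i^*} + \Big(\prod_{\ell \in \mathcal{I}_{\mathrm{P}}} (1-p_\ell)^{y_\ell^*}\Big) \sum_{i \in \mathcal{I}_{\mathrm{P}}} [\ln(1-p_i)]\, y_i^*,$$ $$a_i(y^* ) := -[\ln(1-p_i)] \prod_{\ell \in \mathcal{I}_{\mathrm{P}}} (1-p_\ell)^{y_\ell^*}, \quad i \in \mathcal{I}_{\mathrm{P}}.$$ *)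

theory Defs
  imports Complex_Main
begin

text \<open>
  Vectors indexed by the finite set \<open>I\<close> are total functions on the ambient index type; only
  their values on \<open>I\<close> are ever constrained or used, so the index set may be empty.
  The exponents in products are natural numbers, for which \<open>0 ^ 0 = 1\<close>.
\<close>

definition I_P :: "'i set \<Rightarrow> ('i \<Rightarrow> real) \<Rightarrow> 'i set" where
  "I_P I p = {i \<in> I. 0 \<le> p i \<and> p i < 1}"

definition I_F :: "'i set \<Rightarrow> ('i \<Rightarrow> real) \<Rightarrow> 'i set" where
  "I_F I p = {i \<in> I. p i = 1}"

definition feasible_set ::
    "'i set \<Rightarrow> nat \<Rightarrow> ('i \<Rightarrow> real) \<Rightarrow> (real \<times> ('i \<Rightarrow> nat) \<times> ('i \<Rightarrow> nat)) set" where
  "feasible_set I K p =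
     {(\<eta>, y, z). \<eta> \<le> 1 - (\<Prod>i\<in>I. (1 - p i) ^ y i) \<and>
        (\<forall>i\<in>I. z i \<in> {0, 1} \<and> z i \<le> y i \<and> y i \<le> K * z i)}"

definition oa_const :: "'i set \<Rightarrow> ('i \<Rightarrow> real) \<Rightarrow> ('i \<Rightarrow> nat) \<Rightarrow> real" where
  "oa_const I p ys =
     1 - (\<Prod>i\<in>I_P I p. (1 - p i) ^ ys i)
       + (\<Prod>l\<in>I_P I p. (1 - p l) ^ ys l) * (\<Sum>i\<in>I_P I p. ln (1 - p i) * real (ys i))"

definition oa_coeff :: "'i set \<Rightarrow> ('i \<Rightarrow> real) \<Rightarrow> ('i \<Rightarrow> nat) \<Rightarrow> 'i \<Rightarrow> real" where
  "oa_coeff I p ys i = - ln (1 - p i) * (\<Prod>l\<in>I_P I p. (1 - p l) ^ ys l)"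

definition large_coeffs :: "'i set \<Rightarrow> ('i \<Rightarrow> real) \<Rightarrow> ('i \<Rightarrow> nat) \<Rightarrow> 'i set" where
  "large_coeffs I p ys = {i \<in> I_P I p. oa_coeff I p ys i \<ge> 1 - oa_const I p ys}"

definition oa_rhs ::
    "'i set \<Rightarrow> ('i \<Rightarrow> real) \<Rightarrow> ('i \<Rightarrow> nat) \<Rightarrow> ('i \<Rightarrow> real) \<Rightarrow> real" where
  "oa_rhs I p ys y =
     oa_const I p ys + (\<Sum>i\<in>I_P I p. oa_coeff I p ys i * y i) + (\<Sum>i\<in>I_F I p. y i)"

definition enhanced_oa_rhs ::
    "'i set \<Rightarrow> ('i \<Rightarrow> real) \<Rightarrow> ('i \<Rightarrow> nat) \<Rightarrow> ('i \<Rightarrow> real) \<Rightarrow> ('i \<Rightarrow> real) \<Rightarrow> real" where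
  "enhanced_oa_rhs I p ys y z =
     oa_const I p ys
       + (\<Sum>i\<in>I_P I p - large_coeffs I p ys. oa_coeff I p ys i * y i)
       + (1 - oa_const I p ys) * (\<Sum>i\<in>I_F I p \<union> large_coeffs I p ys. z i)"

end

theory Submission
  imports Defs
begin

text \<open>
  Write \<open>P = (\<Prod>i\<in>I_P I p. (1 - p i) ^ ys i)\<close> and \<open>Q\<close> for the same product with exponents \<open>y\<close>.
  Since \<open>ln\<close> turns these products into linear forms,
  the constant of the outer approximation is \<open>c = 1 - P + P * ln P\<close>, and
  \<open>c + (\<Sum>i\<in>I_P I p. oa_coeff I p ys i * y i) = 1 - P + P * ln P - P * ln Q\<close> is the tangent at
  \<open>ys\<close> of the concave function \<open>1 - Q\<close>. From \<open>ln x \<le> x - 1\<close> come both the tangent bound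
  (\<open>one_minus_prod_le_tangent\<close>) and \<open>0 \<le> c \<le> 1\<close> (\<open>oa_const_nonneg\<close>, \<open>oa_const_le_one\<close>).

  Validity: let \<open>S = I_F I p \<union> large_coeffs I p ys\<close>. If some \<open>z i\<close> with \<open>i \<in> S\<close> equals 1, the
  right-hand side is at least \<open>c + (1 - c) = 1\<close>, which no feasible \<open>\<eta>\<close> exceeds. Otherwise
  \<open>z\<close>, and hence \<open>y\<close>, vanishes on \<open>S\<close>: the terms replaced by the enhancement all vanish, the
  factors with \<open>p i = 1\<close> are \<open>0 ^ 0 = 1\<close>, and the tangent bound applies.

  Strength: the two right-hand sides differ only on \<open>S\<close>, and there the coefficient \<open>1 - c\<close> is
  at most the old coefficient: by the choice of the large coefficients, or, where
  \<open>p i = 1\<close>, because \<open>0 \<le> c\<close>. As \<open>z i \<le> y i\<close>, the comparison holds term by term.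
\<close>

lemma I_P_un_I_F:
  assumes "\<forall>i\<in>I. 0 \<le> p i \<and> p i \<le> 1"
  shows "I_P I p \<union> I_F I p = I"
  using assms unfolding I_P_def I_F_def by force

lemma I_P_int_I_F: "I_P I p \<inter> I_F I p = {}"
  unfolding I_P_def I_F_def by auto

lemma finite_I_P: "finite I \<Longrightarrow> finite (I_P I p)"
  and finite_I_F: "finite I \<Longrightarrow> finite (I_F I p)"
  unfolding I_P_def I_F_def by auto

lemma large_coeffs_subset: "large_coeffs I p ys \<subseteq> I_P I p"
  unfolding large_coeffs_def by auto

lemma prod_I_P_pos: "0 < (\<Prod>i\<in>I_P I p. (1 - p i) ^ ys i)"
  unfolding I_P_def by (intro prod_pos) auto

lemma prod_I_P_le_one: "(\<Prod>i\<in>I_P I p. (1 - p i) ^ ys i) \<le> 1"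
  unfolding I_P_def by (intro prod_le_1) (auto intro: power_le_one)

lemma ln_prod_I_P:
  "ln (\<Prod>i\<in>I_P I p. (1 - p i) ^ ys i) = (\<Sum>i\<in>I_P I p. ln (1 - p i) * real (ys i))"
proof -
  have "ln (\<Prod>i\<in>I_P I p. (1 - p i) ^ ys i) = (\<Sum>i\<in>I_P I p. ln ((1 - p i) ^ ys i))"
    by (cases "finite (I_P I p)", rule ln_prod) (auto simp: I_P_def)
  also have "\<dots> = (\<Sum>i\<in>I_P I p. ln (1 - p i) * real (ys i))"
    by (intro sum.cong) (auto simp: I_P_def ln_realpow)
  finally show ?thesis .
qed

lemma oa_const_eq:
  fixes I p ys
  defines "P \<equiv> \<Prod>i\<in>I_P I p. (1 - p i) ^ ys i"
  shows "oa_const I p ys = 1 - P + P * ln P"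
  unfolding oa_const_def P_def ln_prod_I_P ..

lemma oa_const_le_one: "oa_const I p ys \<le> 1"
proof -
  define P where "P = (\<Prod>i\<in>I_P I p. (1 - p i) ^ ys i)"
  have "0 < P" "P \<le> 1"
    unfolding P_def by (rule prod_I_P_pos prod_I_P_le_one)+
  then have "P * ln P \<le> 0"
    by (simp add: mult_nonneg_nonpos)
  then show ?thesis
    using \<open>0 < P\<close> unfolding oa_const_eq P_def[symmetric] by linarith
qed

text \<open>
  The tangent to a concave function lies above it. For \<open>P, Q > 0\<close> the claim reads
  \<open>P * ln (Q / P) \<le> Q - P\<close>.
\<close>
lemma one_minus_le_tangent:
  fixes P Q :: real
  assumes "0 < P" "0 < Q"
  shows "1 - Q \<le> 1 - P + P * ln P - P * ln Q"
proof -
  have "P * ln (Q / P) \<le> P * (Q / P - 1)"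
    using assms by (intro mult_left_mono ln_le_minus_one) auto
  then have "P * (ln Q - ln P) \<le> Q - P"
    using assms by (simp add: ln_div right_diff_distrib)
  then show ?thesis
    by (simp add: right_diff_distrib)
qed

text \<open>The constant is the value at \<open>y = 0\<close> of the tangent to a function that is 0 there.\<close>
lemma oa_const_nonneg: "0 \<le> oa_const I p ys"
  using one_minus_le_tangent[of "\<Prod>i\<in>I_P I p. (1 - p i) ^ ys i" 1]
  by (simp add: oa_const_eq prod_I_P_pos)

lemma one_minus_prod_le_tangent:
  "1 - (\<Prod>i\<in>I_P I p. (1 - p i) ^ y i)
     \<le> oa_const I p ys + (\<Sum>i\<in>I_P I p. oa_coeff I p ys i * real (y i))"
proof -
  define P where "P = (\<Prod>i\<in>I_P I p. (1 - p i) ^ ys i)"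
  define Q where "Q = (\<Prod>i\<in>I_P I p. (1 - p i) ^ y i)"
  have "(\<Sum>i\<in>I_P I p. oa_coeff I p ys i * real (y i)) = - P * ln Q"
    unfolding Q_def ln_prod_I_P oa_coeff_def P_def[symmetric] sum_distrib_left
    by (intro sum.cong) auto
  moreover have "1 - Q \<le> 1 - P + P * ln P - P * ln Q"
    by (rule one_minus_le_tangent) (simp_all add: P_def Q_def prod_I_P_pos)
  ultimately show ?thesis
    unfolding oa_const_eq P_def[symmetric] Q_def[symmetric] by simp
qed

lemma oa_coeff_nonneg:
  assumes "i \<in> I_P I p"
  shows "0 \<le> oa_coeff I p ys i"
  using assms prod_I_P_pos[of p ys I]
  unfolding oa_coeff_def by (intro mult_nonneg_nonneg) (auto simp: I_P_def)

lemma enhanced_oa_valid: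
  assumes fin: "finite I" and p: "\<forall>i\<in>I. 0 \<le> p i \<and> p i \<le> 1"
    and feas: "(\<eta>, y, z) \<in> feasible_set I K p"
  shows "\<eta> \<le> enhanced_oa_rhs I p ys (\<lambda>i. real (y i)) (\<lambda>i. real (z i))"
proof -
  let ?c = "oa_const I p ys" and ?a = "oa_coeff I p ys" and ?L = "large_coeffs I p ys"
  let ?S = "I_F I p \<union> ?L"
  have eta: "\<eta> \<le> 1 - (\<Prod>i\<in>I. (1 - p i) ^ y i)"
    and z01: "\<And>i. i \<in> I \<Longrightarrow> z i \<in> {0, 1}"
    and yz: "\<And>i. i \<in> I \<Longrightarrow> y i \<le> K * z i"
    using feas unfolding feasible_set_def by auto
  have SI: "?S \<subseteq> I"
    using large_coeffs_subset[of I p ys] I_P_un_I_F[OF p] by blast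
  then have finS: "finite ?S"
    using fin by (rule finite_subset)
  show ?thesis
  proof (cases "\<exists>i\<in>?S. z i = 1")
    case True
    then obtain j where j: "j \<in> ?S" "z j = 1" by blast
    have "0 \<le> (\<Prod>i\<in>I. (1 - p i) ^ y i)"
      using p by (intro prod_nonneg) auto
    then have "\<eta> \<le> 1" using eta by simp
    moreover have "1 \<le> (\<Sum>i\<in>?S. real (z i))"
      using member_le_sum[of j ?S "\<lambda>i. real (z i)"] j finS by simp
    then have "(1 - ?c) * 1 \<le> (1 - ?c) * (\<Sum>i\<in>?S. real (z i))"
      using oa_const_le_one[of I p ys] by (intro mult_left_mono) auto
    moreover have "0 \<le> (\<Sum>i\<in>I_P I p - ?L. ?a i * real (y i))"
      by (intro sum_nonneg mult_nonneg_nonneg oa_coeff_nonneg) auto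
    ultimately show ?thesis
      unfolding enhanced_oa_rhs_def by simp
  next
    case False
    then have z0: "z i = 0" and y0: "y i = 0" if "i \<in> ?S" for i
      using that SI z01[of i] yz[of i] by auto
    have "(\<Prod>i\<in>I. (1 - p i) ^ y i) = (\<Prod>i\<in>I_P I p. (1 - p i) ^ y i)"
    proof (rule prod.mono_neutral_right[OF fin])
      show "I_P I p \<subseteq> I"
        unfolding I_P_def by auto
      show "\<forall>i\<in>I - I_P I p. (1 - p i) ^ y i = 1"
        using I_P_un_I_F[OF p] y0 by auto
    qed
    then have "\<eta> \<le> ?c + (\<Sum>i\<in>I_P I p. ?a i * real (y i))"
      using eta one_minus_prod_le_tangent[of p y I ys] by simp
    also have "(\<Sum>i\<in>I_P I p. ?a i * real (y i)) = (\<Sum>i\<in>I_P I p - ?L. ?a i * real (y i))"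
      using y0 by (intro sum.mono_neutral_right finite_I_P[OF fin]) auto
    finally show ?thesis
      unfolding enhanced_oa_rhs_def using z0 by simp
  qed
qed

lemma enhanced_oa_rhs_le_oa_rhs:
  assumes fin: "finite I"
    and z_nonneg: "\<And>i. i \<in> I \<Longrightarrow> 0 \<le> z i" and zy: "\<And>i. i \<in> I \<Longrightarrow> z i \<le> y i"
  shows "enhanced_oa_rhs I p ys y z \<le> oa_rhs I p ys y"
proof -
  let ?c = "oa_const I p ys" and ?a = "oa_coeff I p ys" and ?L = "large_coeffs I p ys"
  have LP: "?L \<subseteq> I_P I p"
    by (rule large_coeffs_subset)
  have finL: "finite ?L"
    using LP finite_I_P[OF fin] by (rule finite_subset)
  have c: "0 \<le> ?c" "?c \<le> 1"
    by (rule oa_const_nonneg oa_const_le_one)+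
  have onF: "(\<Sum>i\<in>I_F I p. (1 - ?c) * z i) \<le> (\<Sum>i\<in>I_F I p. y i)"
  proof (rule sum_mono)
    fix i assume "i \<in> I_F I p"
    then have i: "i \<in> I" unfolding I_F_def by simp
    have "(1 - ?c) * z i \<le> 1 * z i"
      using c z_nonneg[OF i] by (intro mult_right_mono) auto
    then show "(1 - ?c) * z i \<le> y i"
      using zy[OF i] by simp
  qed
  have onL: "(\<Sum>i\<in>?L. (1 - ?c) * z i) \<le> (\<Sum>i\<in>?L. ?a i * y i)"
  proof (rule sum_mono)
    fix i assume "i \<in> ?L"
    then have i: "i \<in> I" and a: "1 - ?c \<le> ?a i"
      unfolding large_coeffs_def I_P_def by auto
    show "(1 - ?c) * z i \<le> ?a i * y i"
      using a c zy[OF i] z_nonneg[OF i] by (intro mult_mono) auto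
  qed
  have "(1 - ?c) * (\<Sum>i\<in>I_F I p \<union> ?L. z i)
      = (\<Sum>i\<in>I_F I p. (1 - ?c) * z i) + (\<Sum>i\<in>?L. (1 - ?c) * z i)"
    unfolding sum_distrib_left
    using I_P_int_I_F[of I p] LP by (intro sum.union_disjoint finite_I_F[OF fin] finL) auto
  moreover have "(\<Sum>i\<in>I_P I p. ?a i * y i)
      = (\<Sum>i\<in>I_P I p - ?L. ?a i * y i) + (\<Sum>i\<in>?L. ?a i * y i)"
    by (rule sum.subset_diff[OF LP finite_I_P[OF fin]])
  ultimately show ?thesis
    using onF onL unfolding enhanced_oa_rhs_def oa_rhs_def by simp
qed

theorem mainTheorem2:
  fixes I :: "'i set" and K :: nat and p :: "'i \<Rightarrow> real" and ys :: "'i \<Rightarrow> nat"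
  assumes "finite I" and "K \<ge> 2" and "\<forall>i\<in>I. 0 \<le> p i \<and> p i \<le> 1"
  shows "(\<forall>(\<eta>, y, z) \<in> feasible_set I K p.
            \<eta> \<le> enhanced_oa_rhs I p ys (\<lambda>i. real (y i)) (\<lambda>i. real (z i)))
       \<and> (\<forall>(y :: 'i \<Rightarrow> real) (z :: 'i \<Rightarrow> real).
            (\<forall>i\<in>I. 0 \<le> y i \<and> 0 \<le> z i \<and> z i \<le> 1 \<and> z i \<le> y i \<and> y i \<le> real K * z i) \<longrightarrow>
            enhanced_oa_rhs I p ys y z \<le> oa_rhs I p ys y)"
proof (intro conjI allI impI)
  show "\<forall>(\<eta>, y, z) \<in> feasible_set I K p.
      \<eta> \<le> enhanced_oa_rhs I p ys (\<lambda>i. real (y i)) (\<lambda>i. real (z i))"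
    using enhanced_oa_valid[OF assms(1,3)] by blast
next
  fix y z :: "'i \<Rightarrow> real"
  assume "\<forall>i\<in>I. 0 \<le> y i \<and> 0 \<le> z i \<and> z i \<le> 1 \<and> z i \<le> y i \<and> y i \<le> real K * z i"
  then show "enhanced_oa_rhs I p ys y z \<le> oa_rhs I p ys y"
    by (intro enhanced_oa_rhs_le_oa_rhs[OF assms(1)]) auto
qed

end
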